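(* Let $C_n(t)$ be the Narayana polynomials and let $C_n^{(4)}(t)$ be defined by $\sum_{n\ge 0}C_n^{(4)}(t)z^n=\Bigl(\sum_{n\ge 0}C_{n+1}(t)z^n\Bigr)^2$. Let $D(n,4,t)=\det\bigl(C_{i+j}^{(4)}(t)\bigr)_{i,j=0}^{n-1}$. Then for all integers $n\ge 0$ $$D(2n,4,t)=(-1)^n\,t^{2(n^2-n)}\,[n+1]_{t^2},\qquad D(2n+1,4,t)=(-1)^n\,t^{2n^2}\,[n+1]_{t^2}.$$
   Context: The Narayana polynomials are $C_0(t)=1$ and $C_n(t)=\sum_{k=0}^{n}\binom nk\binom{n-1}{k}\frac{1}{k+1}t^k$ for $n>0$. Notation: $[n]_q=1+q+\cdots+q^{n-1}$, so $[n+1]_{t^2}=1+t^2+t^4+\cdots+t^{2n}$. Identities are between polynomials in the indeterminate $t$. The determinant of the empty ($0\times 0$) matrix is $1$. *)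

theory Defs
  imports
    "HOL-Computational_Algebra.Computational_Algebra"
    "Jordan_Normal_Form.Determinant"
begin

text \<open>The indeterminate \<open>t\<close>. The coefficients lie in the rationals because of the factor
  \<open>1/(k+1)\<close> in the Narayana polynomials.\<close>

abbreviation t :: "rat poly" where
  "t \<equiv> [:0, 1:]"

definition narayana :: "nat \<Rightarrow> rat poly" where
  "narayana n =
     (if n = 0 then 1
      else \<Sum>k=0..n. monom (of_nat (n choose k) * of_nat ((n - 1) choose k) * (1 / of_nat (k + 1))) k)"

definition narayana4 :: "nat \<Rightarrow> rat poly" where
  "narayana4 n = fps_nth ((Abs_fps (\<lambda>m. narayana (m + 1)))\<^sup>2) n"

definition hankel_D4 :: "nat \<Rightarrow> rat poly" where
  "hankel_D4 n = det (mat n n (\<lambda>(i, j). narayana4 (i + j)))"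

definition q_bracket :: "nat \<Rightarrow> rat poly \<Rightarrow> rat poly" where
  "q_bracket n q = (\<Sum>i<n. q ^ i)"

end

(*
  Put q = t and c = 1 + t. The series f = sum C_(n+1) z^n satisfies f = 1 + c z f + q z^2 f^2, as one
  sees from the three-term recurrence of the Narayana polynomials: 1 - c z - 2 q z^2 f
  and the square root of (1 - c z)^2 - 4 q z^2 solve the same linear differential equation.
  Let p_k be the monic orthogonal polynomials of the moments of f, in the variable y = x - c, so that
  y p_k = p_(k+1) + q p_(k-1). The moments of f^2 belong, up to the factor q, to the functional of f
  multiplied by x p_1 = y (y + c). Hence their Hankel determinant is, up to a power of q, the
  determinant of a truncation of the pentadiagonal matrix of multiplication by y (y + c).
  The combination of the vectors p_k(0) and p_k(-c) whose entry at k = n vanishes is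
  mapped by the n x n truncation to a multiple of the last unit vector, and Cramer's rule evaluates the
  determinant as the Wronskian-like quotient of Christoffel's formula.
*)
theory Submission
  imports Defs
begin

subsection \<open>The generating function of the Narayana polynomials\<close>

text \<open>The reciprocal factorial, extended by \<open>0\<close> to negative arguments, obeys its recurrence on all
  integers; so the three-term recurrence needs no case distinction at the ends of the support.\<close>

definition rfact :: "int \<Rightarrow> rat" where
  "rfact m = (if m < 0 then 0 else 1 / fact (nat m))"

lemma rfact_rec: "rfact m = of_int (m + 1) * rfact (m + 1)"
proof (cases "m \<ge> 0")
  case True
  then obtain n where "m = int n" using nonneg_int_cases by blast
  moreover have "nat (int n + 1) = Suc n" by simp
  moreover have "rat_of_nat (Suc n) \<noteq> 0" by (rule of_nat_neq_0)
  ultimately show ?thesis by (simp add: rfact_def divide_simps add.commute)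
qed (auto simp: rfact_def)

text \<open>The coefficient of t^k in C_(n+1), in factorials only and for integer \<open>k\<close>:
  multiplication by \<open>t\<close> is then the shift from k to k - 1, without boundary
  cases.\<close>

definition narayana_coeff :: "nat \<Rightarrow> int \<Rightarrow> rat" where
  "narayana_coeff n k =
     fact n * fact (n + 1) * rfact k * rfact (k + 1) * rfact (int n + 1 - k) * rfact (int n - k)"

lemma coeff_narayana_Suc: "coeff (narayana (Suc n)) k = narayana_coeff n (int k)"
proof -
  have "coeff (narayana (Suc n)) k =
      of_nat (Suc n choose k) * of_nat (n choose k) * (1 / of_nat (k + 1))"
    by (auto simp: narayana_def coeff_sum coeff_monom sum.delta binomial_eq_0)
  also have "\<dots> = narayana_coeff n (int k)"
  proof (cases "k \<le> n")
    case True
    then obtain m where n: "n = k + m" using le_Suc_ex by blast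
    have [simp]: "nat (int k + 1) = Suc k" "nat (int m + 1) = Suc m"
         "nat (1 + int m) = Suc m" "nat (1 + int k) = Suc k" by auto
    show ?thesis
      by (simp add: n narayana_coeff_def rfact_def binomial_fact Suc_diff_le
          del: of_nat_Suc of_nat_add)
        (simp add: field_simps)
  qed (auto simp: narayana_coeff_def rfact_def)
  finally show ?thesis .
qed

lemma narayana_coeff_neg: "k < 0 \<Longrightarrow> narayana_coeff n k = 0"
  by (simp add: narayana_coeff_def rfact_def)

text \<open>Each reciprocal factorial is a polynomial in \<open>n\<close> and \<open>k\<close> times
  1/(k+1)! or 1/(n+3-k)!, also where it vanishes; what remains is a polynomial identity.\<close>

lemma narayana_coeff_rec:
  "of_nat (n + 4) * narayana_coeff (n + 2) k =
     of_nat (2 * n + 5) * (narayana_coeff (n + 1) k + narayana_coeff (n + 1) (k - 1))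
   - of_nat (n + 1) * (narayana_coeff n k - 2 * narayana_coeff n (k - 1) + narayana_coeff n (k - 2))"
proof -
  define x where "x = rfact (k + 1)"
  define y where "y = rfact (int n + 3 - k)"
  define K where "K = (of_int k :: rat)"
  define N where "N = (of_nat n :: rat)"
  have step: "rfact m = z * rfact m'" if "m' = m + 1" "of_int m' = z" for m m' z
    using rfact_rec[of m] that by simp
  have k0: "rfact k = (K + 1) * x"
    unfolding x_def by (rule step) (simp_all add: K_def)
  have k1: "rfact (k - 1) = K * ((K + 1) * x)"
    unfolding k0[symmetric] by (rule step) (simp_all add: K_def)
  have k2: "rfact (k - 2) = (K - 1) * (K * ((K + 1) * x))"
    unfolding k1[symmetric] by (rule step) (simp_all add: K_def)
  have m2: "rfact (int n + 2 - k) = (N + 3 - K) * y"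
    unfolding y_def by (rule step) (simp_all add: K_def N_def)
  have m1: "rfact (int n + 1 - k) = (N + 2 - K) * ((N + 3 - K) * y)"
    unfolding m2[symmetric] by (rule step) (simp_all add: K_def N_def)
  have m0: "rfact (int n - k) = (N + 1 - K) * ((N + 2 - K) * ((N + 3 - K) * y))"
    unfolding m1[symmetric] by (rule step) (simp_all add: K_def N_def)
  define F where "F = (fact n :: rat)"
  have f0: "fact n = F" and f1: "fact (n + 1) = (N + 1) * F" and f2: "fact (n + 2) = (N + 2) * (N + 1) * F"
    and f3: "fact (n + 3) = (N + 3) * (N + 2) * (N + 1) * F"
    by (simp_all add: N_def F_def numeral_3_eq_3 algebra_simps)
  have args:
    "int (n + 2) + 1 - k = int n + 3 - k" "int (n + 2) - k = int n + 2 - k"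
    "int (n + 1) + 1 - k = int n + 2 - k" "int (n + 1) - k = int n + 1 - k"
    "int (n + 1) + 1 - (k - 1) = int n + 3 - k" "int (n + 1) - (k - 1) = int n + 2 - k"
    "int n + 1 - (k - 1) = int n + 2 - k" "int n - (k - 1) = int n + 1 - k"
    "int n + 1 - (k - 2) = int n + 3 - k" "int n - (k - 2) = int n + 2 - k"
    "k - 1 + 1 = k" "k - 2 + 1 = k - 1" "n + 1 + 1 = n + 2" "n + 2 + 1 = n + 3"
    by simp_all
  have e2: "narayana_coeff (n + 2) k =
      fact (n + 2) * fact (n + 3) * rfact k * rfact (k + 1) * rfact (int n + 3 - k) * rfact (int n + 2 - k)"
    and e10: "narayana_coeff (n + 1) k =
      fact (n + 1) * fact (n + 2) * rfact k * rfact (k + 1) * rfact (int n + 2 - k) * rfact (int n + 1 - k)"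
    and e11: "narayana_coeff (n + 1) (k - 1) =
      fact (n + 1) * fact (n + 2) * rfact (k - 1) * rfact k * rfact (int n + 3 - k) * rfact (int n + 2 - k)"
    and e00: "narayana_coeff n k =
      fact n * fact (n + 1) * rfact k * rfact (k + 1) * rfact (int n + 1 - k) * rfact (int n - k)"
    and e01: "narayana_coeff n (k - 1) =
      fact n * fact (n + 1) * rfact (k - 1) * rfact k * rfact (int n + 2 - k) * rfact (int n + 1 - k)"
    and e02: "narayana_coeff n (k - 2) =
      fact n * fact (n + 1) * rfact (k - 2) * rfact (k - 1) * rfact (int n + 3 - k) * rfact (int n + 2 - k)"
    by (simp_all only: narayana_coeff_def args)
  have n: "of_nat (n + 4) = N + 4" "of_nat (2 * n + 5) = 2 * N + 5" "of_nat (n + 1) = N + 1"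
    by (simp_all add: N_def)
  show ?thesis
    unfolding n e2 e10 e11 e00 e01 e02 f0 f1 f2 f3 k0 k1 k2 m0 m1 m2 x_def[symmetric] y_def[symmetric]
    by (simp add: algebra_simps)
qed

lemma coeff_t_mult_narayana:
  "coeff (t * narayana (Suc n)) k = narayana_coeff n (int k - 1)"
  "coeff (t * (t * narayana (Suc n))) k = narayana_coeff n (int k - 2)"
proof -
  consider "k = 0" | "k = 1" | j where "k = Suc (Suc j)"
    by (metis One_nat_def not0_implies_Suc)
  then show "coeff (t * narayana (Suc n)) k = narayana_coeff n (int k - 1)"
    "coeff (t * (t * narayana (Suc n))) k = narayana_coeff n (int k - 2)"
    by (cases; simp add: coeff_narayana_Suc narayana_coeff_neg)+
qed

lemma narayana_three_term:
  "of_nat (n + 4) * narayana (n + 3) =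
     of_nat (2 * n + 5) * ((1 + t) * narayana (n + 2)) - of_nat (n + 1) * ((1 - t)\<^sup>2 * narayana (n + 1))"
proof (rule poly_eqI)
  fix k
  have *: "coeff (of_nat m * p) k = of_nat m * coeff p k" for m and p :: "rat poly"
    by (simp add: of_nat_poly)
  have 1: "(1 + t) * narayana (n + 2) = narayana (Suc (n + 1)) + t * narayana (Suc (n + 1))"
    by (simp only: distrib_right mult_1_left Suc_eq_plus1 add.assoc one_add_one)
  have square: "(1 - x)\<^sup>2 * p = p - x * p - x * p + x * (x * p)" for x p :: "rat poly"
    by (simp add: power2_eq_square algebra_simps)
  have 2: "(1 - t)\<^sup>2 * narayana (n + 1) =
      narayana (Suc n) - t * narayana (Suc n) - t * narayana (Suc n) + t * (t * narayana (Suc n))"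
    unfolding Suc_eq_plus1 by (rule square)
  have 3: "narayana (n + 3) = narayana (Suc (n + 2))" by (simp add: numeral_3_eq_3)
  show "coeff (of_nat (n + 4) * narayana (n + 3)) k =
    coeff (of_nat (2 * n + 5) * ((1 + t) * narayana (n + 2))
      - of_nat (n + 1) * ((1 - t)\<^sup>2 * narayana (n + 1))) k"
    unfolding coeff_diff * 1 2 3 coeff_add coeff_t_mult_narayana coeff_narayana_Suc narayana_coeff_rec
    by (simp add: algebra_simps)
qed

text \<open>Because R has constant term 1, coefficient m of the equation expresses (m + 1) T_(m+1)
  through T_0, ..., T_m; characteristic 0 lets m + 1 be cancelled.\<close>

lemma fps_ODE_unique_zero:
  fixes R G T :: "'a::{idom,ring_char_0} fps"
  assumes ode: "R * fps_deriv T = G * T" and R: "fps_nth R 0 = 1" and T: "fps_nth T 0 = 0"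
  shows "T = 0"
proof -
  have "fps_nth T n = 0" for n
  proof (induction n rule: less_induct)
    case (less n)
    show ?case
    proof (cases n)
      case 0
      then show ?thesis using T by simp
    next
      case (Suc m)
      have "fps_nth (R * fps_deriv T) m = (\<Sum>i=0..m. fps_nth R i * fps_nth (fps_deriv T) (m - i))"
        by (rule fps_mult_nth)
      also have "\<dots> = (\<Sum>i=0..m. if i = 0 then of_nat (Suc m) * fps_nth T (Suc m) else 0)"
        using less Suc R by (intro sum.cong) (auto simp del: of_nat_Suc)
      also have "\<dots> = of_nat (Suc m) * fps_nth T (Suc m)" by (simp del: of_nat_Suc)
      finally have "of_nat (Suc m) * fps_nth T (Suc m) = fps_nth (G * T) m" by (simp only: ode)
      also have "\<dots> = 0"
        using less Suc by (auto simp: fps_mult_nth intro!: sum.neutral)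
      finally show ?thesis using Suc of_nat_neq_0[of m, where 'a = 'a] by (simp del: of_nat_Suc)
    qed
  qed
  then show ?thesis by (simp add: fps_eq_iff)
qed

text \<open>With c = 1 + q, S = 1 - c z - 2 q z^2 f and R = (1 - c z)^2 - 4 q z^2 the claim is S^2 =
  R. The recurrence and initial values give 2 R S' = R' S, so T = S^2 - R satisfies R T' = R' T and
  T(0) = 0, whence T = 0.\<close>

lemma fps_quadratic_of_three_term:
  fixes a :: "nat \<Rightarrow> 'a::{idom,ring_char_0}" and q :: 'a
  assumes a0: "a 0 = 1" and a1: "a 1 = 1 + q" and q0: "q \<noteq> 0"
    and rec: "\<And>n. of_nat (n + 4) * a (n + 2)
      = of_nat (2 * n + 5) * ((1 + q) * a (n + 1)) - of_nat (n + 1) * ((1 - q)\<^sup>2 * a n)"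
  defines "f \<equiv> Abs_fps a"
  shows "f = 1 + fps_const (1 + q) * fps_X * f + fps_const q * fps_X\<^sup>2 * f\<^sup>2"
proof -
  define Q where "Q = fps_const q"
  define C where "C = fps_const (1 + q)"
  define E where "E = fps_const ((1 - q)\<^sup>2)"
  have CQ: "C = 1 + Q" by (simp add: C_def Q_def flip: fps_const_add)
  have EQ: "E = (1 - Q)\<^sup>2"
    by (simp add: E_def Q_def power2_eq_square flip: fps_const_mult fps_const_sub)
  define S where "S = 1 - C * fps_X - 2 * Q * fps_X\<^sup>2 * f"
  define R where "R = (1 - C * fps_X)\<^sup>2 - 4 * Q * fps_X\<^sup>2"
  have "2 * Q = fps_const (2 * q)"
    by (simp add: Q_def numeral_fps_const)
  then have "S = 1 - C * fps_X - fps_const (2 * q) * (fps_X * (fps_X * f))"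
    by (simp add: S_def power2_eq_square mult.assoc del: fps_const_mult)
  then have S: "fps_nth S 0 = 1" "fps_nth S (Suc 0) = - (1 + q)"
     "fps_nth S (Suc (Suc n)) = - (2 * q * a n)" for n
    by (simp_all add: C_def Q_def f_def)
  \<comment> \<open>Since (1 + q)^2 - 4 q = (1 - q)^2, the coefficients of \<open>R\<close> are
    those of the recurrence.\<close>
  have R: "R = 1 - 2 * C * fps_X + E * fps_X\<^sup>2"
    unfolding R_def CQ EQ by (simp add: power2_eq_square algebra_simps)
  have "2 * C = fps_const (2 * (1 + q))"
    by (simp add: C_def numeral_fps_const)
  then have R1: "R * g = g - fps_const (2 * (1 + q)) * (fps_X * g) + E * (fps_X * (fps_X * g))" for g
    unfolding R by (simp add: power2_eq_square left_diff_distrib distrib_right mult.assoc)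
  have "fps_nth (R * fps_deriv S) n = fps_nth (E * (fps_X * S) - C * S) n" for n
  proof -
    \<comment> \<open>As S_(m+2) = -2 q a_m, the recurrence enters only from coefficient 3 on; the
      first three need only initial values.\<close>
    consider "n = 0" | "n = 1" | "n = 2" | m where "n = Suc (Suc (Suc m))"
      by (metis One_nat_def numeral_2_eq_2 not0_implies_Suc)
    then show ?thesis
    proof cases
      case 4
      have "of_nat (m + 4) * (2 * q * a (m + 2)) = 2 * q * (of_nat (m + 4) * a (m + 2))"
        by (simp only: mult.left_commute)
      then show ?thesis using 4 unfolding rec R1 C_def E_def
        by (simp add: S, simp add: algebra_simps)
    qed (simp_all add: R1 C_def E_def S a0 a1[unfolded One_nat_def] numeral_2_eq_2 algebra_simps power2_eq_square)
  qed
  then have ode: "R * fps_deriv S = (E * fps_X - C) * S"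
    by (simp add: fps_eq_iff algebra_simps)
  have dR: "fps_deriv R = 2 * (E * fps_X - C)"
    unfolding R by (simp add: E_def C_def power2_eq_square algebra_simps)
  have "R * fps_deriv (S\<^sup>2 - R) = fps_deriv R * (S\<^sup>2 - R)"
  proof -
    have "R * fps_deriv (S\<^sup>2 - R) = 2 * S * (R * fps_deriv S) - R * fps_deriv R"
      by (simp add: power2_eq_square algebra_simps)
    also have "\<dots> = fps_deriv R * (S\<^sup>2 - R)"
      unfolding ode dR by (simp add: power2_eq_square algebra_simps)
    finally show ?thesis .
  qed
  moreover have R0: "fps_nth R 0 = 1" by (simp add: R_def power2_eq_square)
  ultimately have "S\<^sup>2 - R = 0"
    by (rule fps_ODE_unique_zero) (simp add: S R0 power2_eq_square)
  moreover have "4 * Q * fps_X\<^sup>2 * (1 + C * fps_X * f + Q * fps_X\<^sup>2 * f\<^sup>2 - f) = S\<^sup>2 - R"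
    unfolding S_def R_def by (simp add: power2_eq_square algebra_simps)
  moreover have "4 * Q * fps_X\<^sup>2 \<noteq> 0"
    using q0 by (simp add: Q_def)
  ultimately show ?thesis unfolding C_def Q_def by simp
qed

lemma narayana_gf_quadratic:
  defines "f \<equiv> Abs_fps (\<lambda>m. narayana (m + 1))"
  shows "f = 1 + fps_const (1 + t) * fps_X * f + fps_const t * fps_X\<^sup>2 * f\<^sup>2"
  unfolding f_def
proof (rule fps_quadratic_of_three_term)
  show "narayana (0 + 1) = 1"
    by (simp add: narayana_def)
  show "narayana (1 + 1) = 1 + t"
    by (simp add: narayana_def numeral_2_eq_2 monom_0 monom_Suc one_pCons)
  show "t \<noteq> 0" by simp
  show "of_nat (n + 4) * narayana (n + 2 + 1) = of_nat (2 * n + 5) * ((1 + t) * narayana (n + 1 + 1))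
      - of_nat (n + 1) * ((1 - t)\<^sup>2 * narayana (n + 1))" for n
  proof -
    have "n + 2 + 1 = n + 3" "n + 1 + 1 = n + 2" by simp_all
    then show ?thesis using narayana_three_term[of n] by (simp only:)
  qed
qed

subsection \<open>The pentadiagonal determinant\<close>

text \<open>Row \<open>k\<close> lists the coordinates of \<open>y (y + c) p\<^sub>k\<close> in the basis \<open>p\<^sub>l\<close>. The corner entry is \<open>q\<close> and
  not \<open>2 q\<close> because \<open>y p\<^sub>0 = p\<^sub>1\<close> has no lower term.\<close>

definition penta :: "'a::comm_ring_1 \<Rightarrow> 'a \<Rightarrow> nat \<Rightarrow> nat \<Rightarrow> 'a" where
  "penta c q k l =
     (if l = k + 2 then 1 else 0) + (if l = k + 1 then c else 0)
     + (if l = k then (if k = 0 then q else 2 * q) else 0)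
     + (if k = l + 1 then c * q else 0) + (if k = l + 2 then q\<^sup>2 else 0)"

text \<open>Truncation at \<open>m\<close> can cut off only entries right of the diagonal; those to
  the left stay inside because k < m.\<close>

lemma penta_row_sum:
  assumes "k < m"
  shows "(\<Sum>l<m. penta c q k l * x l) =
     (if k + 2 < m then x (k + 2) else 0) + (if k + 1 < m then c * x (k + 1) else 0)
     + (if k = 0 then q else 2 * q) * x k
     + (if k \<ge> 1 then c * q * x (k - 1) else 0) + (if k \<ge> 2 then q\<^sup>2 * x (k - 2) else 0)"
proof -
  have 1: "k = l + 1 \<longleftrightarrow> k \<ge> 1 \<and> l = k - 1" and 2: "k = l + 2 \<longleftrightarrow> k \<ge> 2 \<and> l = k - 2" for l by auto
  have 3: "(if A \<and> B then z else 0) * y = (if B then (if A then z * y else 0) else (0::'a))" for A B z y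
    by simp
  have 4: "(if B then z else 0) * y = (if B then z * y else (0::'a))" for B z y by simp
  show ?thesis using assms unfolding penta_def 1 2
    by (simp add: distrib_right sum.distrib 3 4 del: mult_zero_left cong: if_cong) auto
qed

lemma penta_col_sum:
  assumes "l < m"
  shows "(\<Sum>k<m. x k * penta c q k l) =
     (if l \<ge> 2 then x (l - 2) else 0) + (if l \<ge> 1 then c * x (l - 1) else 0)
     + (if l = 0 then q else 2 * q) * x l
     + (if l + 1 < m then c * q * x (l + 1) else 0) + (if l + 2 < m then q\<^sup>2 * x (l + 2) else 0)"
proof -
  have 1: "l = k + 1 \<longleftrightarrow> l \<ge> 1 \<and> k = l - 1" and 2: "l = k + 2 \<longleftrightarrow> l \<ge> 2 \<and> k = l - 2" for k by auto
  have 3: "y * (if A \<and> B then z else 0) = (if B then (if A then z * y else 0) else (0::'a))" for A B z y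
    by (simp add: mult.commute)
  have 4: "y * (if B then z else 0) = (if B then z * y else (0::'a))" for B z y
    by (simp add: mult.commute)
  show ?thesis using assms unfolding penta_def 1 2
    by (simp add: distrib_left sum.distrib 3 4 del: mult_zero_right cong: if_cong) auto
qed

text \<open>The orthogonal polynomial p_k at y, a rescaled Chebyshev polynomial of the second kind:
  q^(k/2) U_k(y / (2 sqrt q)).\<close>

fun cheb :: "'a::comm_ring_1 \<Rightarrow> 'a \<Rightarrow> nat \<Rightarrow> 'a" where
  "cheb q y 0 = 1"
| "cheb q y (Suc 0) = y"
| "cheb q y (Suc (Suc k)) = y * cheb q y (Suc k) - q * cheb q y k"

text \<open>The relation y p_k = p_(k+1) + q p_(k-1) is used twice; k + 2 < m keeps the whole row
  inside.\<close>

lemma penta_row_sum_cheb: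
  assumes "k + 2 < m"
  shows "(\<Sum>l<m. penta c q k l * cheb q y l) = y * (y + c) * cheb q y k"
proof -
  consider "k = 0" | "k = 1" | j where "k = Suc (Suc j)"
    by (metis One_nat_def not0_implies_Suc)
  then show ?thesis
    using assms by cases (simp_all add: penta_row_sum, simp_all add: algebra_simps power2_eq_square)
qed

definition penta_mat :: "'a::comm_ring_1 \<Rightarrow> 'a \<Rightarrow> nat \<Rightarrow> 'a mat" where
  "penta_mat c q n = mat n n (\<lambda>(k, l). penta c q k l)"

text \<open>Casorati determinant of p_k at the roots -c and 0 of y (y + c), the numerator in
  Christoffel's formula.\<close>

definition cheb_wronskian :: "'a::comm_ring_1 \<Rightarrow> 'a \<Rightarrow> nat \<Rightarrow> 'a" where
  "cheb_wronskian c q n =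
     cheb q (- c) (Suc n) * cheb q 0 n - cheb q 0 (Suc n) * cheb q (- c) n"

lemma det_penta_mat_rec:
  "det (penta_mat c q (Suc n)) * cheb_wronskian c q n
     = cheb_wronskian c q (Suc n) * det (penta_mat c q n)"
proof -
  \<comment> \<open>Full rows annihilate both p_l(0) and p_l(-c); these weights make the entry at n
    + 1 vanish.\<close>
  define x where "x l = cheb q (- c) (Suc n) * cheb q 0 l - cheb q 0 (Suc n) * cheb q (- c) l" for l
  let ?A = "penta_mat c q (Suc n)"
  let ?x = "vec (Suc n) x"
  define w where "w = cheb_wronskian c q (Suc n)"
  have x1: "x (Suc n) = 0" by (simp add: x_def)
  have x2: "x (Suc (Suc n)) = - w" by (simp add: x_def w_def cheb_wronskian_def algebra_simps)
  have full: "(\<Sum>l<n+3. penta c q k l * x l) = 0" if "k \<le> n" for k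
  proof -
    have "(\<Sum>l<n+3. penta c q k l * x l) =
       cheb q (- c) (Suc n) * (\<Sum>l<n+3. penta c q k l * cheb q 0 l)
       - cheb q 0 (Suc n) * (\<Sum>l<n+3. penta c q k l * cheb q (- c) l)"
      by (simp only: sum_distrib_left sum_subtractf[symmetric] x_def right_diff_distrib mult.left_commute)
    also have "\<dots> = 0" using that by (subst (1 2) penta_row_sum_cheb) auto
    finally show ?thesis .
  qed
  \<comment> \<open>The dropped columns are n + 1, where \<open>x\<close> is 0, and n + 2, which
    only row \<open>n\<close> reaches, with entry 1; hence -x (n + 2) = w remains there.\<close>
  have row: "(\<Sum>l<Suc n. penta c q k l * x l) = (if k = n then w else 0)" if "k \<le> n" for k
    using full[OF that] x1 x2 that
    by (auto simp: numeral_3_eq_3 penta_def)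
  have A: "?A \<in> carrier_mat (Suc n) (Suc n)" by (simp add: penta_mat_def)
  have Ax: "?A *\<^sub>v ?x = vec (Suc n) (\<lambda>k. if k = n then w else 0)"
    using row by (intro eq_vecI)
      (auto simp: penta_mat_def scalar_prod_def atLeast0LessThan)
  define B where "B = replace_col ?A (?A *\<^sub>v ?x) n"
  have B: "B \<in> carrier_mat (Suc n) (Suc n)" using A by (simp add: B_def replace_col_def)
  have "det B = (\<Sum>i<Suc n. B $$ (i, n) * cofactor B i n)"
    by (rule laplace_expansion_column[OF B]) simp
  also have "\<dots> = w * cofactor B n n"
    using A by (simp add: B_def replace_col_def Ax)
  also have "mat_delete B n n = penta_mat c q n"
    by (intro eq_matI) (auto simp: B_def replace_col_def mat_delete_def penta_mat_def)
  then have "cofactor B n n = det (penta_mat c q n)"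
    by (simp add: cofactor_def)
  finally have "det B = w * det (penta_mat c q n)" .
  moreover have "det B = x n * det ?A"
    unfolding B_def by (subst cramer_lemma_mat[OF A]) auto
  ultimately show ?thesis
    by (simp add: w_def x_def cheb_wronskian_def mult.commute)
qed

text \<open>Both sides obey the same first-order recurrence and equal -c at n = 0; nonvanishing
  Wronskians allow the cancellation.\<close>

lemma det_penta_mat:
  fixes c q :: "'a::idom"
  assumes "\<And>n. cheb_wronskian c q n \<noteq> 0"
  shows "- c * det (penta_mat c q n) = cheb_wronskian c q n"
proof (induction n)
  case 0
  then show ?case by (simp add: cheb_wronskian_def penta_mat_def)
next
  case (Suc n)
  have "(- c * det (penta_mat c q (Suc n))) * cheb_wronskian c q n
     = cheb_wronskian c q (Suc n) * (- c * det (penta_mat c q n))"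
    using det_penta_mat_rec[of c q n] by (simp add: algebra_simps)
  then show ?case using assms[of n] by (simp only: Suc mult_cancel_right) simp
qed

subsection \<open>Hankel determinants of the square of the generating function\<close>

text \<open>For a series \<open>f\<close> as below, row \<open>n\<close> lists the coordinates of \<open>x\<^sup>n\<close> in the basis \<open>p\<^sub>k\<close>.\<close>

definition riordan :: "'a::comm_ring_1 fps \<Rightarrow> nat \<Rightarrow> nat \<Rightarrow> 'a" where
  "riordan f n k = fps_nth (fps_X ^ k * f ^ Suc k) n"

lemma riordan_eq_0: "n < k \<Longrightarrow> riordan f n k = 0"
  by (simp add: riordan_def fps_X_power_mult_nth)

lemma fps_square_nth_riordan: "fps_nth (f\<^sup>2) n = riordan f (Suc n) 1"
  by (simp add: riordan_def power2_eq_square)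

context
  fixes c q :: "'a::comm_ring_1" and f :: "'a fps"
  assumes f: "f = 1 + fps_const c * fps_X * f + fps_const q * fps_X\<^sup>2 * f\<^sup>2"
begin

lemma riordan_0_0: "riordan f 0 0 = 1"
  by (subst f) (simp add: riordan_def power2_eq_square)

lemma riordan_diag: "riordan f n n = 1"
  using riordan_0_0 by (simp add: riordan_def fps_X_power_mult_nth fps_nth_power_0)

lemma riordan_Suc_0: "riordan f (Suc n) 0 = c * riordan f n 0 + q * riordan f n 1"
proof -
  have "f = 1 + fps_X * (fps_const c * (fps_X ^ 0 * f ^ Suc 0) + fps_const q * (fps_X ^ 1 * f ^ Suc 1))"
    by (subst f) (simp add: power2_eq_square algebra_simps)
  from arg_cong[OF this, of "\<lambda>g. fps_nth g (Suc n)"] show ?thesis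
    unfolding riordan_def by simp
qed

text \<open>Expanding one factor \<open>f\<close> by its quadratic equation gives the coordinates of
  x^(n+1), in accordance with x p_k = p_(k+1) + c p_k + q p_(k-1).\<close>

lemma riordan_Suc_Suc:
  "riordan f (Suc n) (Suc k) = riordan f n k + c * riordan f n (Suc k) + q * riordan f n (Suc (Suc k))"
proof -
  have "fps_X ^ Suc k * f ^ Suc (Suc k) = fps_X ^ Suc k * f ^ Suc k * f"
    by (simp add: algebra_simps)
  also have "\<dots> = fps_X ^ Suc k * f ^ Suc k * (1 + fps_const c * fps_X * f + fps_const q * fps_X\<^sup>2 * f\<^sup>2)"
    by (subst (2) f) (rule refl)
  also have "\<dots> = fps_X * (fps_X ^ k * f ^ Suc k + fps_const c * (fps_X ^ Suc k * f ^ Suc (Suc k))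
      + fps_const q * (fps_X ^ Suc (Suc k) * f ^ Suc (Suc (Suc k))))"
    by (simp add: power2_eq_square algebra_simps)
  finally have *: "fps_X ^ Suc k * f ^ Suc (Suc k) = \<dots>" .
  show ?thesis unfolding riordan_def
    by (subst *) (simp del: power_Suc)
qed

text \<open>Multiplication by x is symmetric for the form with squared norms q^l, so the partial
  sums differ only by a boundary term, as in the Christoffel-Darboux formula.\<close>

lemma riordan_shift_sum:
  "(\<Sum>l<Suc m. riordan f (Suc i) l * q ^ l * riordan f j l)
     - (\<Sum>l<Suc m. riordan f i l * q ^ l * riordan f (Suc j) l)
   = q ^ Suc m * (riordan f i (Suc m) * riordan f j m - riordan f i m * riordan f j (Suc m))"
proof (induction m)
  case 0
  show ?case by (simp add: riordan_Suc_0 algebra_simps)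
next
  case (Suc m)
  have "(\<Sum>l<Suc (Suc m). riordan f (Suc i) l * q ^ l * riordan f j l)
     - (\<Sum>l<Suc (Suc m). riordan f i l * q ^ l * riordan f (Suc j) l)
    = q ^ Suc m * (riordan f i (Suc m) * riordan f j m - riordan f i m * riordan f j (Suc m))
     + (riordan f (Suc i) (Suc m) * q ^ Suc m * riordan f j (Suc m)
     - riordan f i (Suc m) * q ^ Suc m * riordan f (Suc j) (Suc m))"
    unfolding Suc[symmetric] sum.lessThan_Suc[of _ "Suc m"] by (simp only: algebra_simps)
  then show ?case by (simp add: riordan_Suc_Suc algebra_simps)
qed

text \<open>Factors x move one at a time from the left power to the right; i + j < m makes every
  boundary term vanish.\<close>

lemma riordan_gram_aux:
  "i + j < m \<Longrightarrow> (\<Sum>l<m. riordan f i l * q ^ l * riordan f j l) = riordan f (i + j) 0"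
proof (induction i arbitrary: j)
  case 0
  have "(\<Sum>l<m. riordan f 0 l * q ^ l * riordan f j l) = (\<Sum>l<m. if l = 0 then riordan f j 0 else 0)"
    by (intro sum.cong) (auto simp: riordan_0_0 riordan_eq_0)
  with 0 show ?case by simp
next
  case (Suc i)
  then obtain m' where m: "m = Suc m'" by (cases m) auto
  have "(\<Sum>l<m. riordan f (Suc i) l * q ^ l * riordan f j l)
      = (\<Sum>l<m. riordan f i l * q ^ l * riordan f (Suc j) l)"
    using riordan_shift_sum[where i = i and j = j and m = m'] Suc.prems m
    by (simp add: riordan_eq_0 del: sum.lessThan_Suc)
  with Suc show ?case by simp
qed

text \<open>Terms with l > j vanish, so the sum may be lengthened until
  \<open>riordan_gram_aux\<close> applies. No bound on \<open>i\<close> is imposed, since exponents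
  up to n + 1 occur below.\<close>

lemma riordan_gram:
  assumes "j < n"
  shows "(\<Sum>l<n. riordan f i l * q ^ l * riordan f j l) = riordan f (i + j) 0"
proof -
  have "(\<Sum>l<n. riordan f i l * q ^ l * riordan f j l)
      = (\<Sum>l<n + i + j. riordan f i l * q ^ l * riordan f j l)"
    using assms by (intro sum.mono_neutral_left) (auto simp: riordan_eq_0)
  with assms show ?thesis by (simp add: riordan_gram_aux)
qed

text \<open>This multiplies x^i by y (y + c) = x^2 - c x; as i < n, rows of index at least
  \<open>n\<close> contribute nothing.\<close>

lemma riordan_penta:
  assumes "i < n" "l < n"
  shows "(\<Sum>k<n. riordan f i k * penta c q k l)
    = riordan f (Suc (Suc i)) l - c * riordan f (Suc i) l"
proof -
  have 0: "riordan f i k = 0" if "n \<le> k" for k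
    using assms that by (simp add: riordan_eq_0)
  have *: "(if k < n then a * riordan f i k else 0) = a * riordan f i k" for a k
    using 0[of k] by auto
  consider "l = 0" | "l = 1" | j where "l = Suc (Suc j)"
    by (metis One_nat_def not0_implies_Suc)
  then show ?thesis
    unfolding penta_col_sum[OF assms(2)] *
    by cases (simp_all add: riordan_Suc_0 riordan_Suc_Suc power2_eq_square algebra_simps)
qed

text \<open>q H = P N S, with P unit lower triangular and S upper triangular with diagonal entries
  q^l. The powers of \<open>q\<close> stay on both sides, as \<open>q\<close> need not be
  invertible.\<close>

lemma det_hankel_fps_square:
  "q ^ n * det (mat n n (\<lambda>(i, j). fps_nth (f\<^sup>2) (i + j))) = q ^ (\<Sum>{..<n}) * det (penta_mat c q n)"
proof -
  define H where "H = mat n n (\<lambda>(i, j). fps_nth (f\<^sup>2) (i + j))"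
  define P where "P = mat n n (\<lambda>(i, k). riordan f i k)"
  define S where "S = mat n n (\<lambda>(l, j). q ^ l * riordan f j l)"
  let ?N = "penta_mat c q n"
  have car: "H \<in> carrier_mat n n" "P \<in> carrier_mat n n" "S \<in> carrier_mat n n" "?N \<in> carrier_mat n n"
    by (simp_all add: H_def P_def S_def penta_mat_def)
  have PN: "P * ?N = mat n n (\<lambda>(i, l). riordan f (Suc (Suc i)) l - c * riordan f (Suc i) l)"
    by (intro eq_matI)
      (auto simp: P_def penta_mat_def scalar_prod_def atLeast0LessThan riordan_penta)
  have "(\<Sum>l<n. (riordan f (Suc (Suc i)) l - c * riordan f (Suc i) l) * (q ^ l * riordan f j l))
      = q * fps_nth (f\<^sup>2) (i + j)" if "j < n" for i j
  proof -
    have "(\<Sum>l<n. (riordan f (Suc (Suc i)) l - c * riordan f (Suc i) l) * (q ^ l * riordan f j l))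
      = (\<Sum>l<n. riordan f (Suc (Suc i)) l * q ^ l * riordan f j l)
        - c * (\<Sum>l<n. riordan f (Suc i) l * q ^ l * riordan f j l)"
      by (simp add: sum_distrib_left sum_subtractf[symmetric] algebra_simps)
    also have "\<dots> = riordan f (Suc (Suc (i + j))) 0 - c * riordan f (Suc (i + j)) 0"
      using that by (simp add: riordan_gram)
    \<comment> \<open>The quadratic equation gives f_(m+2) - c f_(m+1) = q [z^m] f^2.\<close>
    finally show ?thesis by (simp add: riordan_Suc_0 fps_square_nth_riordan)
  qed
  then have "q \<cdot>\<^sub>m H = P * ?N * S"
    unfolding PN
    by (intro eq_matI) (auto simp: H_def S_def scalar_prod_def atLeast0LessThan)
  then have "det (q \<cdot>\<^sub>m H) = det P * det ?N * det S"
    using car by (simp only: det_mult[OF mult_carrier_mat[OF car(2) car(4)] car(3)] det_mult[OF car(2) car(4)])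
  then have "q ^ n * det H = det P * det ?N * det S"
    using car by simp
  moreover have "det P = 1"
    by (subst det_lower_triangular[OF _ car(2)])
      (auto simp: P_def riordan_eq_0 riordan_diag prod_list_diag_prod)
  moreover have "det S = q ^ (\<Sum>{..<n})"
    by (subst det_upper_triangular[OF _ car(3)])
      (auto simp: S_def upper_triangular_def riordan_eq_0 riordan_diag prod_list_diag_prod
        power_sum atLeast0LessThan)
  ultimately show ?thesis by (simp add: H_def mult.commute)
qed

end

section \<open>Closed forms at c = 1 + q\<close>

lemma q_bracket_Suc: "q_bracket (Suc n) x = q_bracket n x + x ^ n"
  by (simp add: q_bracket_def)

text \<open>The value at t = 1 is n + 1.\<close>

lemma q_bracket_nonzero: "q_bracket (Suc n) t \<noteq> 0"
proof
  assume "q_bracket (Suc n) t = 0"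
  then have "poly (q_bracket (Suc n) t) 1 = 0" by simp
  then show False
    by (simp add: q_bracket_def poly_sum del: sum.lessThan_Suc of_nat_Suc)
qed

lemma q_bracket_even: "q_bracket (2 * n) x = (1 + x) * q_bracket n (x\<^sup>2)"
proof (induction n)
  case (Suc n)
  have "q_bracket (2 * Suc n) x = q_bracket (2 * n) x + (1 + x) * (x\<^sup>2) ^ n"
    by (simp add: q_bracket_Suc power_mult[symmetric] algebra_simps)
  then show ?case by (simp only: Suc q_bracket_Suc distrib_left)
qed (simp add: q_bracket_def)

lemma cheb_0_even: "cheb q 0 (2 * m) = (- q) ^ m"
  by (induction m) auto

lemma cheb_0_odd: "cheb q 0 (Suc (2 * m)) = 0"
  by (induction m) auto

text \<open>At y = -(1 + q) the characteristic roots of the recurrence are -1 and -q.\<close>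

lemma cheb_q_bracket: "cheb q (- (1 + q)) k = (- 1) ^ k * q_bracket (Suc k) q"
proof (induction k rule: induct_nat_012)
  case (ge2 k)
  show ?case unfolding cheb.simps(3) ge2 by (simp add: q_bracket_Suc algebra_simps)
qed (simp_all add: q_bracket_def)

text \<open>Odd p_k vanish at 0, so one product survives. Its bracket is [2m+2]_q = (1 + q)
  [m+1]_(q^2) here and at 2m + 1, which is why both determinants share a bracket.\<close>

lemma cheb_wronskian_even:
  "cheb_wronskian (1 + q) q (2 * m) = - (1 + q) * ((- q) ^ m * q_bracket (m + 1) (q\<^sup>2))"
proof -
  have "q_bracket (Suc (Suc (2 * m))) q = (1 + q) * q_bracket (m + 1) (q\<^sup>2)"
    using q_bracket_even[of "Suc m" q] by simp
  then show ?thesis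
    unfolding cheb_wronskian_def cheb_0_even cheb_0_odd cheb_q_bracket
    by (simp only:) (simp add: algebra_simps)
qed

lemma cheb_wronskian_odd:
  "cheb_wronskian (1 + q) q (2 * m + 1) = - (1 + q) * ((- 1) ^ m * q ^ (m + 1) * q_bracket (m + 1) (q\<^sup>2))"
proof -
  have "q_bracket (Suc (Suc (2 * m))) q = (1 + q) * q_bracket (m + 1) (q\<^sup>2)"
    using q_bracket_even[of "Suc m" q] by simp
  moreover have "cheb q 0 (Suc (Suc (2 * m))) = (- q) ^ Suc m"
    using cheb_0_even[of q "Suc m"] by simp
  ultimately show ?thesis
    unfolding cheb_wronskian_def Suc_eq_plus1[symmetric, of "2 * m"] cheb_0_odd cheb_q_bracket
    by (simp only:) (simp add: power_minus[of q] algebra_simps)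
qed

lemma sum_lessThan_double: "\<Sum>{..<2 * n} + n = 2 * (n::nat)\<^sup>2"
  by (induction n) (simp_all add: power2_eq_square)

theorem theorem7p4:
  fixes n :: nat
  shows "hankel_D4 (2 * n) = (- 1) ^ n * t ^ (2 * (n\<^sup>2 - n)) * q_bracket (n + 1) (t\<^sup>2)
       \<and> hankel_D4 (2 * n + 1) = (- 1) ^ n * t ^ (2 * n\<^sup>2) * q_bracket (n + 1) (t\<^sup>2)"
proof -
  define f where "f = Abs_fps (\<lambda>m. narayana (m + 1))"
  \<comment> \<open>A separate name keeps \<open>t\<close> from being treated as a coefficient
    list.\<close>
  obtain q :: "rat poly" where q: "q = t" by blast
  have q0: "q \<noteq> 0" and q1: "1 + q \<noteq> 0" by (simp_all add: q one_pCons)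
  have "hankel_D4 m = det (mat m m (\<lambda>(i, j). fps_nth (f\<^sup>2) (i + j)))" for m
    by (simp add: hankel_D4_def narayana4_def f_def)
  then have hankel: "q ^ m * hankel_D4 m = q ^ \<Sum>{..<m} * det (penta_mat (1 + q) q m)" for m
    using det_hankel_fps_square[OF narayana_gf_quadratic, of m] by (simp only: f_def q)
  have br: "q_bracket (m + 1) (q\<^sup>2) \<noteq> 0" for m
  proof
    assume "q_bracket (m + 1) (q\<^sup>2) = 0"
    then have "q_bracket (Suc (Suc (2 * m))) q = 0"
      using q_bracket_even[of "Suc m" q] by simp
    then show False using q_bracket_nonzero by (simp add: q)
  qed
  have "cheb_wronskian (1 + q) q m \<noteq> 0" for m
  proof (cases "even m")
    case True
    then obtain k where m: "m = 2 * k" by blast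
    show ?thesis unfolding m cheb_wronskian_even using q0 q1 br[of k] by simp
  next
    case False
    then obtain k where m: "m = 2 * k + 1" by (elim oddE)
    show ?thesis unfolding m cheb_wronskian_odd using q0 q1 br[of k] by simp
  qed
  then have w: "- (1 + q) * det (penta_mat (1 + q) q m) = cheb_wronskian (1 + q) q m" for m
    by (rule det_penta_mat)
  have neg: "- (1 + q) \<noteq> 0" using q1 by (simp only: neg_equal_0_iff_equal not_False_eq_True)
  have even: "det (penta_mat (1 + q) q (2 * n)) = (- q) ^ n * q_bracket (n + 1) (q\<^sup>2)"
    using w[of "2 * n"] neg unfolding cheb_wronskian_even by (simp only: mult_cancel_left simp_thms)
  have odd: "det (penta_mat (1 + q) q (2 * n + 1)) = (- 1) ^ n * q ^ (n + 1) * q_bracket (n + 1) (q\<^sup>2)"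
    using w[of "2 * n + 1"] neg unfolding cheb_wronskian_odd by (simp only: mult_cancel_left simp_thms)
  \<comment> \<open>This makes the natural-number subtraction n^2 - n a true difference; both
    exponents below are 2 n^2.\<close>
  have "n \<le> n\<^sup>2" by (simp add: power2_eq_square)
  then have "2 * n + 2 * (n\<^sup>2 - n) = \<Sum>{..<2 * n} + n"
    by (simp add: sum_lessThan_double)
  then have e: "q ^ (2 * n) * q ^ (2 * (n\<^sup>2 - n)) = q ^ \<Sum>{..<2 * n} * q ^ n"
    by (simp only: power_add[symmetric])
  have "q ^ (2 * n) * hankel_D4 (2 * n)
      = q ^ (2 * n) * ((- 1) ^ n * q ^ (2 * (n\<^sup>2 - n)) * q_bracket (n + 1) (q\<^sup>2))"
  proof -
    have "q ^ (2 * n) * hankel_D4 (2 * n)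
      = (q ^ \<Sum>{..<2 * n} * q ^ n) * ((- 1) ^ n * q_bracket (n + 1) (q\<^sup>2))"
      unfolding hankel even power_minus[of q] by (simp only: mult_ac)
    also have "\<dots> = q ^ (2 * n) * ((- 1) ^ n * q ^ (2 * (n\<^sup>2 - n)) * q_bracket (n + 1) (q\<^sup>2))"
      unfolding e[symmetric] by (simp only: mult_ac)
    finally show ?thesis .
  qed
  then have 1: "hankel_D4 (2 * n) = (- 1) ^ n * q ^ (2 * (n\<^sup>2 - n)) * q_bracket (n + 1) (q\<^sup>2)"
    using q0 by (simp only: mult_cancel_left power_eq_0_iff simp_thms)
  have "2 * n + 1 + 2 * n\<^sup>2 = \<Sum>{..<2 * n + 1} + (n + 1)"
    using sum_lessThan_double[of n] by simp
  then have o: "q ^ (2 * n + 1) * q ^ (2 * n\<^sup>2) = q ^ \<Sum>{..<2 * n + 1} * q ^ (n + 1)"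
    by (simp only: power_add[symmetric])
  have "q ^ (2 * n + 1) * hankel_D4 (2 * n + 1)
      = q ^ (2 * n + 1) * ((- 1) ^ n * q ^ (2 * n\<^sup>2) * q_bracket (n + 1) (q\<^sup>2))"
  proof -
    have "q ^ (2 * n + 1) * hankel_D4 (2 * n + 1)
      = (q ^ \<Sum>{..<2 * n + 1} * q ^ (n + 1)) * ((- 1) ^ n * q_bracket (n + 1) (q\<^sup>2))"
      unfolding hankel odd by (simp only: mult_ac)
    also have "\<dots> = q ^ (2 * n + 1) * ((- 1) ^ n * q ^ (2 * n\<^sup>2) * q_bracket (n + 1) (q\<^sup>2))"
      unfolding o[symmetric] by (simp only: mult_ac)
    finally show ?thesis .
  qed
  then have 2: "hankel_D4 (2 * n + 1) = (- 1) ^ n * q ^ (2 * n\<^sup>2) * q_bracket (n + 1) (q\<^sup>2)"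
    using q0 by (simp only: mult_cancel_left power_eq_0_iff simp_thms)
  from 1 2 show ?thesis unfolding q by (rule conjI)
qed

end
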